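(* Let $R$ be a ring and let $\Gamma'^{c}(R)$ be the complement unity product graph associated with $R$. Then $\Gamma'^{c}(R)$ is a complete graph if $R$ is isomorphic to any of the following rings: (1) $R\cong S$, where $S$ is a reduced ring with $\mathrm{Char}(S)=0$ and $|U(S)|=2$; (2) $R\cong\mathbb{Z}_n$, where $n>2$ is a divisor of $24$.
   Context: Rings here have a unity $e$. $\mathbb{Z}_n$ is the ring of integers modulo $n$, and $\mathrm{Char}$ denotes the characteristic. $U(R)$ denotes the set of units of $R$. The complement unity product graph $\Gamma'^{c}(R)$ is the simple graph with vertex set $U(R)$ in which two distinct vertices $r_i,r_j$ are adjacent if and only if $r_i\cdot r_j\neq e$. A graph is complete if every two distinct vertices are adjacent. *)

theory Defs
  imports
    "HOL-Algebra.QuotRing"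
    "HOL-Number_Theory.Residues"
    "Graph_Theory.Graph_Theory"
begin

definition ring_char :: "('a, 'm) ring_scheme \<Rightarrow> nat" where
  "ring_char R =
    (if \<exists>n::nat. n > 0 \<and> [n] \<cdot>\<^bsub>R\<^esub> \<one>\<^bsub>R\<^esub> = \<zero>\<^bsub>R\<^esub>
     then LEAST n::nat. n > 0 \<and> [n] \<cdot>\<^bsub>R\<^esub> \<one>\<^bsub>R\<^esub> = \<zero>\<^bsub>R\<^esub>
     else 0)"

definition nilpotent_in :: "('a, 'm) ring_scheme \<Rightarrow> 'a \<Rightarrow> bool" where
  "nilpotent_in R a \<longleftrightarrow>
    a \<in> carrier R \<and> (\<exists>n::nat. n > 0 \<and> a [^]\<^bsub>R\<^esub> n = \<zero>\<^bsub>R\<^esub>)"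

definition reduced_ring :: "('a, 'm) ring_scheme \<Rightarrow> bool" where
  "reduced_ring R \<longleftrightarrow> ring R \<and> (\<forall>a. nilpotent_in R a \<longrightarrow> a = \<zero>\<^bsub>R\<^esub>)"

(* An undirected simple graph is encoded by a vertex set together with a symmetric
   irreflexive arc relation.  The library locale pair_graph also demands finiteness,
   which is not available here for an arbitrary ring. *)
definition complement_unity_product_graph :: "('a, 'm) ring_scheme \<Rightarrow> 'a pair_pre_digraph" where
  "complement_unity_product_graph R =
    \<lparr> pverts = Units R,
      parcs = {(r, s). r \<in> Units R \<and> s \<in> Units R \<and> r \<noteq> s \<and> r \<otimes>\<^bsub>R\<^esub> s \<noteq> \<one>\<^bsub>R\<^esub>} \<rparr>"

(* R need not be commutative, but r s = 1 implies s r = 1 for units, so adjacency is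
   symmetric. *)
lemma complement_unity_product_graph_simple:
  fixes R (structure)
  assumes "ring R"
  shows "pair_wf_digraph (complement_unity_product_graph R)"
    and "sym (parcs (complement_unity_product_graph R))"
    and "irrefl (parcs (complement_unity_product_graph R))"
proof -
  interpret ring R by fact
  show "pair_wf_digraph (complement_unity_product_graph R)"
    by unfold_locales (auto simp: complement_unity_product_graph_def)
  have "s \<otimes> r = \<one>" if "r \<in> Units R" "s \<in> Units R" "r \<otimes> s = \<one>" for r s
  proof -
    have "inv r = s"
      by (rule inv_unique [of _ r]) (use that in \<open>simp_all add: Units_closed\<close>)
    then show ?thesis using Units_l_inv [OF that(1)] by simp
  qed
  then show "sym (parcs (complement_unity_product_graph R))"
    unfolding complement_unity_product_graph_def sym_def by auto
  show "irrefl (parcs (complement_unity_product_graph R))"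
    by (auto simp: complement_unity_product_graph_def irrefl_def)
qed

(* The library's complete_digraph n G additionally fixes the (finite) order n. *)
definition complete_graph :: "'a pair_pre_digraph \<Rightarrow> bool" where
  "complete_graph G \<longleftrightarrow> (\<forall>u \<in> pverts G. \<forall>v \<in> pverts G. u \<noteq> v \<longrightarrow> (u, v) \<in> parcs G)"

lemma complete_graph_iff_complete_digraph:
  assumes "pair_graph G"
  shows "complete_graph G \<longleftrightarrow> complete_digraph (card (pverts G)) (with_proj G)"
proof -
  interpret pair_graph G by fact
  have "complete_graph G \<longleftrightarrow> parcs G = {(u, v). (u, v) \<in> pverts G \<times> pverts G \<and> u \<noteq> v}"
    unfolding complete_graph_def by (auto dest: in_arcsD1 in_arcsD2 no_loops')
  then show ?thesis
    unfolding complete_digraph_pair_def using pair_finite_verts assms by auto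
qed

end

theory Submission
  imports Defs
begin

text \<open>
  The only edges that can be missing from the complement unity product graph join a unit to its
  inverse. So the graph is complete as soon as every unit is its own inverse, since then the
  excluded pairs are loops. This condition on the units is invariant under ring isomorphism, which
  leaves the two families of rings to examine. A group of order two has exponent two, so the
  condition holds whenever there are exactly two units. For \<open>\<int>\<^sub>n\<close> with \<open>n\<close> dividing 24, it holds
  because an odd square is 1 modulo 8 and the square of an integer prime to 3 is 1 modulo 3: these
  two congruences control the 2-part and the 3-part of \<open>n\<close> separately.
\<close>

lemma complete_complement_unity_product_graph_if_units_self_inverse:
  fixes R (structure)
  assumes "ring R" and self_inverse: "\<And>u. u \<in> Units R \<Longrightarrow> u \<otimes> u = \<one>"
  shows "complete_graph (complement_unity_product_graph R)"
proof -
  interpret ring R by fact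
  have "r = s" if "r \<in> Units R" "s \<in> Units R" "r \<otimes> s = \<one>" for r s
  proof -
    have "r \<otimes> s = r \<otimes> r" using that self_inverse by simp
    then show ?thesis using that by (simp add: Units_closed)
  qed
  then show ?thesis
    unfolding complete_graph_def complement_unity_product_graph_def
      pair_pre_digraph.simps mem_Collect_eq prod.case by blast
qed

text \<open>
  The isomorphism carries \<open>u\<close> to a unit, so the images of \<open>u \<otimes> u\<close> and \<open>\<one>\<close> agree, and injectivity
  pulls this equation back.
\<close>

lemma units_self_inverse_if_iso:
  assumes "ring R" and "R \<simeq> S"
    and self_inverse: "\<And>v. v \<in> Units S \<Longrightarrow> v \<otimes>\<^bsub>S\<^esub> v = \<one>\<^bsub>S\<^esub>"
    and u: "u \<in> Units R"
  shows "u \<otimes>\<^bsub>R\<^esub> u = \<one>\<^bsub>R\<^esub>"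
proof -
  interpret ring R by fact
  obtain h where "h \<in> ring_iso R S"
    using \<open>R \<simeq> S\<close> unfolding is_ring_iso_def by blast
  then have hom: "h \<in> ring_hom R S" and inj: "inj_on h (carrier R)"
    by (auto simp: ring_iso_def bij_betw_def)
  have uR: "u \<in> carrier R" "inv\<^bsub>R\<^esub> u \<in> carrier R"
    using u by (simp_all add: Units_closed)
  have "h u \<otimes>\<^bsub>S\<^esub> h (inv\<^bsub>R\<^esub> u) = \<one>\<^bsub>S\<^esub>" "h (inv\<^bsub>R\<^esub> u) \<otimes>\<^bsub>S\<^esub> h u = \<one>\<^bsub>S\<^esub>"
    using u uR by (simp_all add: ring_hom_one [OF hom] flip: ring_hom_mult [OF hom])
  then have "h u \<in> Units S"
    using uR ring_hom_closed [OF hom] unfolding Units_def by blast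
  then have "h (u \<otimes>\<^bsub>R\<^esub> u) = h \<one>\<^bsub>R\<^esub>"
    using self_inverse uR by (simp add: ring_hom_mult [OF hom] ring_hom_one [OF hom])
  then show ?thesis
    using inj uR by (meson inj_onD m_closed one_closed)
qed

lemma (in monoid) units_self_inverse_if_card_2:
  assumes card: "card (Units G) = 2" and u: "u \<in> Units G"
  shows "u \<otimes> u = \<one>"
proof (cases "u = \<one>")
  case False
  have "finite (Units G)" using card by (metis card.infinite zero_neq_numeral)
  moreover have "{\<one>, u} \<subseteq> Units G" "card {\<one>, u} = 2" using u False by auto
  ultimately have "Units G = {\<one>, u}" using card by (metis card_subset_eq)
  moreover have "u \<otimes> u \<in> Units G" using u by simp
  \<comment> \<open>The product could otherwise only be the non-identity unit itself, and no unit other than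
    the identity is idempotent.\<close>
  moreover have "u \<otimes> u \<noteq> u"
    using u False by (metis Units_closed Units_l_cancel one_closed r_one)
  ultimately show ?thesis by blast
qed simp

text \<open>
  Splitting the modulus as a divisor of 8 times a divisor of 3 separates the two primes. Either
  factor may be a unit, in which case nothing is known about \<open>a\<close> at that prime, but nothing has to be
  shown there either.
\<close>

lemma square_cong_1_mod_divisor_of_24:
  fixes a n :: int
  assumes "n dvd 24" and "coprime a n"
  shows "[a * a = 1] (mod n)"
proof -
  obtain b c where n: "n = b * c" and b: "b dvd 8" and c: "c dvd 3"
    using division_decomp [of n 8 3] assms(1) by auto
  have "b dvd a * a - 1"
  proof (cases "even b")
    case True
    then have "odd a"
      using assms(2) n coprime_common_divisor [of a n 2] by auto
    then have "a mod 8 \<in> {1, 3, 5, 7}"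
      by (simp; presburger)
    then have "(a mod 8) * (a mod 8) mod 8 = 1 mod 8" by auto
    then have "8 dvd a * a - 1"
      unfolding mod_mult_eq mod_eq_dvd_iff .
    with b show ?thesis by (rule dvd_trans)
  next
    case False
    then have "coprime b 8" using coprime_power_right_iff [of b 2 3] by simp
    then have "is_unit b" using b by (rule coprime_common_divisor [OF _ dvd_refl])
    then show ?thesis by (rule unit_imp_dvd)
  qed
  moreover have "c dvd a * a - 1"
  proof (cases "3 dvd c")
    case True
    then have "\<not> 3 dvd a"
      using assms(2) n coprime_common_divisor [of a n 3] by auto
    then have "a mod 3 \<in> {1, 2}"
      by (simp; presburger)
    then have "(a mod 3) * (a mod 3) mod 3 = 1 mod 3" by auto
    then have "3 dvd a * a - 1"
      unfolding mod_mult_eq mod_eq_dvd_iff .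
    with c show ?thesis by (rule dvd_trans)
  next
    case False
    have "coprime 3 c"
      using False by (intro prime_imp_coprime) simp_all
    then have "is_unit c" using c by (rule coprime_common_divisor [OF _ _ dvd_refl])
    then show ?thesis by (rule unit_imp_dvd)
  qed
  moreover have "coprime b c"
    by (rule coprime_divisors [OF b c])
      (simp add: prime_imp_coprime [of 3] coprime_commute [of 8])
  ultimately have "n dvd a * a - 1"
    unfolding n by (rule divides_mult)
  then show ?thesis by (simp add: cong_iff_dvd_diff)
qed

lemma residue_ring_units_self_inverse:
  fixes n :: int
  assumes "n > 1" and "n dvd 24" and u: "u \<in> Units (residue_ring n)"
  shows "u \<otimes>\<^bsub>residue_ring n\<^esub> u = \<one>\<^bsub>residue_ring n\<^esub>"
proof -
  interpret residues n "residue_ring n" using \<open>n > 1\<close> by unfold_locales simp_all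
  have "coprime u n" using u by (simp add: res_units_eq)
  then have "[u * u = 1] (mod n)"
    using assms(2) by (intro square_cong_1_mod_divisor_of_24)
  then show ?thesis
    using \<open>n > 1\<close> by (simp add: res_mult_eq res_one_eq cong_def)
qed

theorem proposition3p3:
  fixes R :: "('a, 'm) ring_scheme"
  assumes "ring R"
    and "(\<exists>S :: ('b, 'n) ring_scheme.
            reduced_ring S \<and> ring_char S = 0 \<and> card (Units S) = 2 \<and> R \<simeq> S) \<or>
         (\<exists>n :: nat. n > 2 \<and> n dvd 24 \<and> R \<simeq> residue_ring (int n))"
  shows "complete_graph (complement_unity_product_graph R)"
  using assms(2)
proof (elim disjE exE conjE)
  fix S :: "('b, 'n) ring_scheme"
  assume "reduced_ring S" and card: "card (Units S) = 2" and iso: "R \<simeq> S"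
  then interpret S: ring S by (simp add: reduced_ring_def)
  show ?thesis
    using assms(1) units_self_inverse_if_iso [OF assms(1) iso S.units_self_inverse_if_card_2 [OF card]]
    by (rule complete_complement_unity_product_graph_if_units_self_inverse)
next
  fix n :: nat
  assume "n > 2" and "n dvd 24" and iso: "R \<simeq> residue_ring (int n)"
  then have n: "int n > 1" "int n dvd 24"
    using of_nat_dvd_iff [of n 24, where ?'a = int] by simp_all
  show ?thesis
    using assms(1) units_self_inverse_if_iso [OF assms(1) iso residue_ring_units_self_inverse [OF n]]
    by (rule complete_complement_unity_product_graph_if_units_self_inverse)
qed

end
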